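(* Let $G$ be a braced polygon graph. Then the following two conditions are equivalent: (i) every strictly convex braced polygon $(G,\mathbf p)$ in $\mathbb{R}^2$ with underlying braced polygon graph $G$ is infinitesimally rigid; (ii) every strictly convex braced polygon $(G,\mathbf p)$ in $\mathbb{R}^2$ with underlying braced polygon graph $G$ is convexly rigid.
   Context: A braced polygon graph is a finite simple graph $G$ on vertices $1,\dots,n$ ($n\ge 3$) with a distinguished Hamilton cycle whose edges $\{i,i+1\}$ (indices modulo $n$) are called boundary edges; the other edges are called braces (interior edges). A convex polygon in the plane is strictly convex if each vertex lies on a line that intersects the polygon only at this vertex. A strictly convex braced polygon $(G,\mathbf p)$ is a realisation $\mathbf p=(p_1,\dots,p_n)$, $p_i\in\mathbb{R}^2$, of $G$ such that $p_1,\dots,p_n$ are, in this cyclic order, the vertices of a strictly convex polygon whose edges are the segments $p_ip_{i+1}$ (indices modulo $n$). An infinitesimal flex of a framework $(G,\mathbf p)$ in $\mathbb{R}^d$ is $\mathbf p'=(p'_1,\dots,p'_n)$ with $p_i'\in\mathbb{R}^d$ and $(p_i-p_j)\cdot(p'_i-p'_j)=0$ for every edge $ij$ of $G$. It is trivial if it is the derivative of a smooth family of congruences of $\mathbb{R}^d$ restricted to $\mathbf p$. $(G,\mathbf p)$ is infinitesimally rigid if every infinitesimal flex is trivial. Two frameworks $(G,\mathbf p)$, $(G,\mathbf q)$ are congruent if $\|p_i-p_j\|=\|q_i-q_j\|$ for all $1\le i<j\le n$. A strictly convex braced polygon $(G,\mathbf p)$ is convexly rigid if every strictly convex braced polygon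 $(G,\mathbf q)$ with $\|q_i-q_j\|=\|p_i-p_j\|$ for every edge $ij$ of $G$ is congruent to $(G,\mathbf p)$. *)

theory Defs
  imports "HOL-Analysis.Analysis"
begin

text \<open>
  A simple graph on the vertices \<open>1, \<dots>, n\<close> is given by its set of edges, each of them a
  two-element set of vertices. A configuration is a function on \<open>nat\<close> of which only
  the values at \<open>1, \<dots>, n\<close> are relevant; every notion below depends on these values only.
\<close>

definition simple_graph :: "nat \<Rightarrow> nat set set \<Rightarrow> bool" where
  "simple_graph n E \<longleftrightarrow> (\<forall>e\<in>E. e \<subseteq> {1..n} \<and> card e = 2)"

text \<open>Cyclic successor on \<open>{1..n}\<close>: \<open>i \<mapsto> i + 1\<close> for \<open>i < n\<close>, and \<open>n \<mapsto> 1\<close>.\<close>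

definition cyc_next :: "nat \<Rightarrow> nat \<Rightarrow> nat" where
  "cyc_next n i = i mod n + 1"

definition boundary_edges :: "nat \<Rightarrow> nat set set" where
  "boundary_edges n = {{i, cyc_next n i} | i. i \<in> {1..n}}"

definition braced_polygon_graph :: "nat \<Rightarrow> nat set set \<Rightarrow> bool" where
  "braced_polygon_graph n E \<longleftrightarrow> n \<ge> 3 \<and> simple_graph n E \<and> boundary_edges n \<subseteq> E"

text \<open>
  The polygon is the closed region \<open>convex hull (p ` {1..n})\<close>; it has to be two-dimensional,
  and its boundary has to consist of the prescribed edges. Non-empty interior must be
  demanded: a line through the middle one of three collinear points can meet their hull in
  that point only. The last conjunct is strict convexity. It makes all \<open>p i\<close> corners of the
  hull, so that \<open>n\<close> segments can cover the frontier only if the \<open>p i\<close> occur on it in cyclic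
  order.
\<close>

definition strictly_convex_polygon :: "nat \<Rightarrow> (nat \<Rightarrow> real ^ 2) \<Rightarrow> bool" where
  "strictly_convex_polygon n p \<longleftrightarrow>
     inj_on p {1..n} \<and>
     interior (convex hull (p ` {1..n})) \<noteq> {} \<and>
     frontier (convex hull (p ` {1..n})) =
       (\<Union>i\<in>{1..n}. closed_segment (p i) (p (cyc_next n i))) \<and>
     (\<forall>i\<in>{1..n}. \<exists>L. affine L \<and> aff_dim L = 1 \<and> L \<inter> convex hull (p ` {1..n}) = {p i})"

definition strictly_convex_braced_polygon ::
    "nat \<Rightarrow> nat set set \<Rightarrow> (nat \<Rightarrow> real ^ 2) \<Rightarrow> bool" where
  "strictly_convex_braced_polygon n E p \<longleftrightarrow>
     braced_polygon_graph n E \<and> strictly_convex_polygon n p"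

definition infinitesimal_flex ::
    "nat set set \<Rightarrow> (nat \<Rightarrow> real ^ 'd) \<Rightarrow> (nat \<Rightarrow> real ^ 'd) \<Rightarrow> bool" where
  "infinitesimal_flex E p p' \<longleftrightarrow>
     (\<forall>i j. {i, j} \<in> E \<longrightarrow> (p i - p j) \<bullet> (p' i - p' j) = 0)"

definition is_congruence :: "(real ^ 'd \<Rightarrow> real ^ 'd) \<Rightarrow> bool" where
  "is_congruence f \<longleftrightarrow> (\<forall>x y. dist (f x) (f y) = dist x y)"

text \<open>\<open>D k\<close> is the \<open>k\<close>-th derivative of the curve.\<close>

definition smooth_curve :: "(real \<Rightarrow> real ^ 'd) \<Rightarrow> bool" where
  "smooth_curve c \<longleftrightarrow>
     (\<exists>D. D 0 = c \<and> (\<forall>k t. (D k has_vector_derivative D (Suc k) t) (at t)))"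

text \<open>
  Smoothness in \<open>t\<close> for each fixed point \<open>x\<close> already gives joint smoothness in \<open>(t, x)\<close>, because
  a congruence is an affine map and so depends on finitely many of its values only.
\<close>

definition smooth_congruence_family :: "(real \<Rightarrow> real ^ 'd \<Rightarrow> real ^ 'd) \<Rightarrow> bool" where
  "smooth_congruence_family \<Phi> \<longleftrightarrow>
     (\<forall>t. is_congruence (\<Phi> t)) \<and> (\<forall>x. smooth_curve (\<lambda>t. \<Phi> t x))"

definition trivial_flex :: "nat \<Rightarrow> (nat \<Rightarrow> real ^ 'd) \<Rightarrow> (nat \<Rightarrow> real ^ 'd) \<Rightarrow> bool" where
  "trivial_flex n p p' \<longleftrightarrow>
     (\<exists>\<Phi>. smooth_congruence_family \<Phi> \<and> \<Phi> 0 = id \<and>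
        (\<forall>i\<in>{1..n}. ((\<lambda>t. \<Phi> t (p i)) has_vector_derivative p' i) (at 0)))"

definition infinitesimally_rigid :: "nat \<Rightarrow> nat set set \<Rightarrow> (nat \<Rightarrow> real ^ 'd) \<Rightarrow> bool" where
  "infinitesimally_rigid n E p \<longleftrightarrow> (\<forall>p'. infinitesimal_flex E p p' \<longrightarrow> trivial_flex n p p')"

definition congruent :: "nat \<Rightarrow> (nat \<Rightarrow> real ^ 'd) \<Rightarrow> (nat \<Rightarrow> real ^ 'd) \<Rightarrow> bool" where
  "congruent n p q \<longleftrightarrow>
     (\<forall>i\<in>{1..n}. \<forall>j\<in>{1..n}. i < j \<longrightarrow> norm (p i - p j) = norm (q i - q j))"

definition convexly_rigid :: "nat \<Rightarrow> nat set set \<Rightarrow> (nat \<Rightarrow> real ^ 2) \<Rightarrow> bool" where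
  "convexly_rigid n E p \<longleftrightarrow>
     (\<forall>q. strictly_convex_braced_polygon n E q \<longrightarrow>
          (\<forall>i j. {i, j} \<in> E \<longrightarrow> norm (q i - q j) = norm (p i - p j)) \<longrightarrow>
          congruent n p q)"

end

theory Submission
  imports Defs
begin

text \<open>
  Both implications rest on one identity, \<open>(x + y) \<bullet> (x - y) = (norm x)\<^sup>2 - (norm y)\<^sup>2\<close>, applied
  to the difference vectors of two frameworks \<open>p\<close> and \<open>q\<close> along an edge: the frameworks have
  equal edge lengths exactly if \<open>p - q\<close> is an infinitesimal flex of \<open>p + q\<close>.

  If \<open>p\<close> has a nontrivial flex \<open>p'\<close>, then \<open>p + t p'\<close> and \<open>p - t p'\<close> have equal edge lengths. For
  small \<open>t\<close> both are strictly convex polygons, since strict convexity is an open condition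
  (\<open>ccw_perturbation\<close>), but they are not congruent: a flex that preserves all pairwise distances
  to first order is trivial (\<open>orthogonal_imp_trivial_flex\<close>). So convex rigidity of all
  realisations forces infinitesimal rigidity of all of them.

  Conversely, let \<open>p\<close> and \<open>q\<close> be strictly convex with equal edge lengths. If \<open>p + q\<close> is strictly
  convex as well, its flex \<open>p - q\<close> is trivial, which means that all distances agree. The sum
  need not be convex as it stands, but it becomes so after a suitable congruence of \<open>q\<close>
  (\<open>ccw_average\<close>). First reflect so that both polygons are counterclockwise; then their edges
  have increasing angles \<open>\<theta>\<close> and \<open>\<phi>\<close> within one full turn. The oscillation of \<open>\<theta> - \<phi>\<close> is less
  than \<open>2 * pi\<close>, so a rotation of \<open>q\<close> brings all these differences strictly between \<open>- pi\<close> and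
  \<open>pi\<close>. Boundary edges have equal lengths in both polygons, hence those of the sum point along
  the averaged angles, which again increase within one full turn, and this makes the sum a
  convex polygon (\<open>ccw_if_edge_angles_increase\<close>).

  Throughout, strict convexity is used in the form that all triples of vertices, taken in the
  order of their indices, have the same orientation. Its equivalence with the description by
  convex hull, frontier and touching lines is \<open>strictly_convex_polygon_imp_ccw\<close> and
  \<open>ccw_imp_strictly_convex_polygon\<close>.
\<close>

section \<open>Orientation of triples of points\<close>

definition cross2 :: "real ^ 2 \<Rightarrow> real ^ 2 \<Rightarrow> real" where
  "cross2 a b = a $ 1 * b $ 2 - a $ 2 * b $ 1"

definition orient :: "real ^ 2 \<Rightarrow> real ^ 2 \<Rightarrow> real ^ 2 \<Rightarrow> real" where
  "orient a b c = cross2 (b - a) (c - a)"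

text \<open>
  The sign of \<open>s\<close> records the direction in which the polygon is traversed: positive for
  counterclockwise. The vertices are \<open>P 0, \<dots>, P (n - 1)\<close>. All triples are included, and not
  only consecutive ones, so that pentagrams and other star polygons are excluded.
\<close>
definition ccw :: "real \<Rightarrow> nat \<Rightarrow> (nat \<Rightarrow> real ^ 2) \<Rightarrow> bool" where
  "ccw s n P \<longleftrightarrow> (\<forall>i j k. i < j \<longrightarrow> j < k \<longrightarrow> k < n \<longrightarrow> 0 < s * orient (P i) (P j) (P k))"

lemma inner_2: "(x :: real ^ 2) \<bullet> y = x $ 1 * y $ 1 + x $ 2 * y $ 2"
  by (simp add: inner_vec_def sum_2)

lemma vec2_eq_iff: "(x :: real ^ 2) = y \<longleftrightarrow> x $ 1 = y $ 1 \<and> x $ 2 = y $ 2"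
  by (simp add: vec_eq_iff forall_2)

lemma cross2_bilinear:
  "cross2 (a + b) c = cross2 a c + cross2 b c" "cross2 c (a + b) = cross2 c a + cross2 c b"
  "cross2 (a - b) c = cross2 a c - cross2 b c" "cross2 c (a - b) = cross2 c a - cross2 c b"
  "cross2 (r *\<^sub>R a) b = r * cross2 a b" "cross2 a (r *\<^sub>R b) = r * cross2 a b"
  "cross2 a a = 0" "cross2 0 b = 0" "cross2 a 0 = 0"
  by (simp_all add: cross2_def algebra_simps)

lemma orient_rotate: "orient b c a = orient a b c"
  by (simp add: orient_def cross2_def algebra_simps)

lemma orient_swap: "orient a c b = - orient a b c"
  by (simp add: orient_def cross2_def algebra_simps)

lemma orient_refl [simp]: "orient a a b = 0" "orient a b a = 0" "orient a b b = 0"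
  by (simp_all add: orient_def cross2_def)

lemma cross2_plucker: "cross2 u b * cross2 a c = cross2 u a * cross2 b c + cross2 u c * cross2 a b"
  by (simp add: cross2_def algebra_simps)

text \<open>
  Turning left is not a transitive relation on plane vectors, but it becomes one on the open
  half plane to one side of a vector \<open>u\<close>. The Pluecker relation gives this without angles.
\<close>
lemma cross2_trans_half_plane:
  assumes "0 < s * cross2 u a" "0 < s * cross2 u b" "0 < s * cross2 u c"
    and "0 < s * cross2 a b" "0 < s * cross2 b c"
  shows "0 < s * cross2 a c"
proof -
  have "(s * cross2 u b) * (s * cross2 a c)
      = (s * cross2 u a) * (s * cross2 b c) + (s * cross2 u c) * (s * cross2 a b)"
    using cross2_plucker[of u b a c] by algebra
  also have "\<dots> > 0" using assms by (simp add: add_pos_pos)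
  finally show ?thesis using assms(2) by (simp add: zero_less_mult_iff)
qed

text \<open>
  If all vertices lie strictly on the same side of every edge line, then so do all triples:
  seen from \<open>P i\<close>, the later vertices lie in the half plane of the edge at \<open>P i\<close>, in which
  consecutive ones all turn the same way, and such turns are transitive there. The sequence is taken with
  period \<open>n\<close>, so that wrapping around the polygon needs no case distinction.
\<close>
lemma ccw_if_edges_support:
  assumes period: "\<And>k. P (k + n) = P k"
    and edge: "\<And>i j. 2 \<le> j \<Longrightarrow> j < n \<Longrightarrow> 0 < s * orient (P i) (P (Suc i)) (P (i + j))"
  shows "ccw s n P"
  unfolding ccw_def
proof (intro allI impI)
  fix i j k :: nat
  assume ij: "i < j" and jk: "j < k" and kn: "k < n"
  define v where "v m = P m - P i" for m
  have first: "0 < s * cross2 (v (Suc i)) (v m)" if "Suc i < m" "m < n" for m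
  proof -
    have "0 < s * orient (P i) (P (Suc i)) (P (i + (m - i)))"
      using that by (intro edge) auto
    then show ?thesis using that by (simp add: orient_def v_def)
  qed
  have consec: "0 < s * cross2 (v m) (v (Suc m))" if "i < m" "Suc m < n" for m
  proof -
    have "0 < s * orient (P m) (P (Suc m)) (P (m + (n - (m - i))))"
      using that by (intro edge) auto
    moreover have "m + (n - (m - i)) = i + n" using that by auto
    ultimately show ?thesis
      using that period[of i] by (metis orient_def orient_rotate v_def)
  qed
  have "0 < s * cross2 (v j) (v k)" using Suc_leI[OF jk] kn
  proof (induction k rule: dec_induct)
    case base
    then show ?case using consec ij by simp
  next
    case (step k)
    then have IH: "0 < s * cross2 (v j) (v k)" by simp
    have last: "0 < s * cross2 (v k) (v (Suc k))" using consec ij step by simp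
    show ?case
    proof (cases "j = Suc i")
      case True
      then show ?thesis using first[of "Suc k"] step by simp
    next
      case False
      then show ?thesis
        using cross2_trans_half_plane[OF first[of j] first[of k] first[of "Suc k"] IH last] ij step
        by simp
    qed
  qed
  then show "0 < s * orient (P i) (P j) (P k)" by (simp add: orient_def v_def)
qed

section \<open>Strictly convex polygons are those whose vertex triples have one orientation\<close>

text \<open>
  Separating \<open>L\<close> from the interior of \<open>C\<close> suffices because \<open>C\<close> lies in the closure of its
  interior. It is used both for a point of the frontier and for a line that touches \<open>C\<close>.
\<close>
lemma supporting_functional:
  fixes C L :: "'a :: euclidean_space set"
  assumes "convex C" "interior C \<noteq> {}" "convex L" "L \<noteq> {}" "L \<inter> interior C = {}"
  obtains a b where "a \<noteq> 0" "\<And>x. x \<in> C \<Longrightarrow> a \<bullet> x \<le> b" "\<And>x. x \<in> L \<Longrightarrow> b \<le> a \<bullet> x"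
proof -
  obtain a b where ab: "a \<noteq> 0" "\<forall>x\<in>interior C. a \<bullet> x \<le> b" "\<forall>x\<in>L. b \<le> a \<bullet> x"
    using separating_hyperplane_sets[of "interior C" L] assms by (auto simp: convex_interior)
  have "closure (interior C) \<subseteq> {x. a \<bullet> x \<le> b}"
    using ab by (intro closure_minimal closed_halfspace_le) auto
  then have "C \<subseteq> {x. a \<bullet> x \<le> b}"
    using convex_closure_interior[OF assms(1,2)] closure_subset by blast
  then show ?thesis using that[of a b] ab by blast
qed

text \<open>
  Here the dimension two enters: the line \<open>L\<close> fills a whole supporting hyperplane of \<open>C\<close>, and a
  segment of \<open>C\<close> through \<open>x\<close> has to stay inside that hyperplane, hence inside \<open>L \<inter> C\<close>.
\<close>
lemma extreme_point_if_line_touches: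
  fixes C :: "(real ^ 2) set"
  assumes "convex C" "interior C \<noteq> {}" "x \<notin> interior C"
    and "affine L" "aff_dim L = 1" "L \<inter> C = {x}"
  shows "x extreme_point_of C"
proof -
  have "L \<inter> interior C = {}" using assms(3,6) interior_subset[of C] by auto
  then obtain a b where ab: "a \<noteq> 0" "\<And>y. y \<in> C \<Longrightarrow> a \<bullet> y \<le> b" "\<And>y. y \<in> L \<Longrightarrow> b \<le> a \<bullet> y"
    using supporting_functional[of C L] assms affine_imp_convex by blast
  have xb: "a \<bullet> x = b" using ab assms by (intro antisym) auto
  have "L \<subseteq> {y. a \<bullet> y = b}"
  proof
    fix y assume y: "y \<in> L"
    have "2 *\<^sub>R x + (-1) *\<^sub>R y \<in> L"
      using \<open>affine L\<close>[unfolded affine_def, rule_format, of x y 2 "-1"] y assms(6) by auto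
    then have "b \<le> a \<bullet> (2 *\<^sub>R x + (-1) *\<^sub>R y)" by (rule ab)
    then show "y \<in> {y. a \<bullet> y = b}" using xb ab(3)[OF y] by (simp add: inner_diff_right)
  qed
  moreover have "aff_dim {y. a \<bullet> y = b} = 1" using ab(1) by simp
  ultimately have L: "L = {y. a \<bullet> y = b}"
    using assms(4,5,6) by (intro affine_dim_equal affine_hyperplane) auto
  show ?thesis
    unfolding extreme_point_of_def
  proof (intro conjI ballI notI)
    show "x \<in> C" using assms by blast
    fix y z assume yz: "y \<in> C" "z \<in> C" and seg: "x \<in> open_segment y z"
    obtain u where u: "0 < u" "u < 1" "x = (1 - u) *\<^sub>R y + u *\<^sub>R z" and "y \<noteq> z"
      using seg by (auto simp: in_segment)
    have "(1 - u) * (b - a \<bullet> y) + u * (b - a \<bullet> z) = 0"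
      using xb u(3) by (simp add: inner_add_right algebra_simps)
    moreover have "0 \<le> (1 - u) * (b - a \<bullet> y)" "0 \<le> u * (b - a \<bullet> z)"
      using ab(2) yz u by auto
    ultimately have "(1 - u) * (b - a \<bullet> y) = 0" "u * (b - a \<bullet> z) = 0" by linarith+
    then have "y \<in> L \<inter> C" "z \<in> L \<inter> C" using u yz L by auto
    then show False using assms \<open>y \<noteq> z\<close> by auto
  qed
qed

lemma cross2_eq_0_parallel:
  assumes "cross2 v w = 0" "v \<noteq> 0"
  obtains t where "w = t *\<^sub>R v"
proof (cases "v $ 1 = 0")
  case True
  then have "v $ 2 \<noteq> 0" using assms(2) by (auto simp: vec2_eq_iff)
  then have "w = (w $ 2 / v $ 2) *\<^sub>R v"
    using assms(1) True by (simp add: vec2_eq_iff cross2_def)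
  then show ?thesis by (rule that)
next
  case False
  then have "w = (w $ 1 / v $ 1) *\<^sub>R v"
    using assms(1) by (simp add: vec2_eq_iff cross2_def field_simps)
  then show ?thesis by (rule that)
qed

lemma orient_eq_0_cases:
  assumes "orient a b c = 0" "a \<noteq> b" "a \<noteq> c" "b \<noteq> c"
  shows "a \<in> open_segment b c \<or> b \<in> open_segment a c \<or> c \<in> open_segment a b"
proof -
  obtain t where "c - a = t *\<^sub>R (b - a)"
    using cross2_eq_0_parallel[of "b - a" "c - a"] assms by (auto simp: orient_def)
  then have "collinear {0, b - a, c - a}" unfolding collinear_lemma by blast
  then have "collinear {b, a, c}" by (subst collinear_3) auto
  then show ?thesis
    using assms(2-)
    by (auto simp: collinear_between_cases between_mem_segment open_segment_def
        closed_segment_commute)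
qed

definition perp :: "real ^ 2 \<Rightarrow> real ^ 2" where
  "perp e = vector [- e $ 2, e $ 1]"

lemma perp_inner: "perp e \<bullet> x = cross2 e x"
  by (simp add: perp_def inner_2 cross2_def)

lemma perp_eq_0_iff [simp]: "perp e = 0 \<longleftrightarrow> e = 0"
  by (auto simp: perp_def vec2_eq_iff)

lemma orthogonal_perp_multiple:
  assumes "a \<bullet> e = 0" "e \<noteq> 0"
  obtains r where "a = r *\<^sub>R perp e"
proof -
  have "cross2 (perp e) a = 0"
    using assms(1) by (simp add: cross2_def perp_def inner_2 algebra_simps)
  then show ?thesis using cross2_eq_0_parallel[of "perp e" a] assms(2) that by auto
qed

lemma same_sign_mult:
  fixes s t x y :: real
  assumes "0 < s * y" "0 < t * y" "0 < t * x"
  shows "0 < s * x"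
  using assms by (auto simp: zero_less_mult_iff)

text \<open>
  A supporting line at the midpoint of an edge contains the whole edge, so all vertices lie on
  one side of it; since vertices are extreme points, no third vertex lies on it. Neighbouring
  edges agree on the side because they share the triangle of three consecutive vertices.
\<close>
lemma strictly_convex_polygon_imp_ccw:
  assumes n: "n \<ge> 3" and scp: "strictly_convex_polygon n p"
  shows "\<exists>s. ccw s n (\<lambda>k. p (Suc k))"
proof -
  define P where "P k = p (k mod n + 1)" for k
  define C where "C = convex hull (p ` {1..n})"
  have inj: "inj_on p {1..n}" and int: "interior C \<noteq> {}"
    and fr: "frontier C = (\<Union>i\<in>{1..n}. closed_segment (p i) (p (cyc_next n i)))"
    and lines: "\<And>i. i \<in> {1..n} \<Longrightarrow> \<exists>L. affine L \<and> aff_dim L = 1 \<and> L \<inter> C = {p i}"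
    using scp unfolding strictly_convex_polygon_def C_def by auto
  have idx: "k mod n + 1 \<in> {1..n}" for k using n by (simp add: Suc_leI)
  have P_eq_iff: "P i = P j \<longleftrightarrow> i mod n = j mod n" for i j
    unfolding P_def using inj_on_eq_iff[OF inj idx idx] by simp
  have convC: "convex C" by (simp add: C_def)
  have PC: "P k \<in> C" for k
    unfolding C_def P_def by (intro hull_inc imageI idx)
  have seg: "closed_segment (P i) (P (Suc i)) \<subseteq> frontier C" for i
  proof -
    have "p (cyc_next n (i mod n + 1)) = P (Suc i)"
      by (simp add: cyc_next_def P_def mod_Suc_eq)
    then show ?thesis unfolding fr using idx[of i]
      by (intro UN_upper[THEN subset_trans[rotated], of "i mod n + 1"]) (auto simp: P_def)
  qed
  have extreme: "P i extreme_point_of C" for i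
  proof -
    have "P i \<notin> interior C" using seg[of i] by (auto simp: frontier_def)
    then show ?thesis
      using lines[OF idx[of i]] extreme_point_if_line_touches[OF convC int] by (auto simp: P_def)
  qed
  have "\<exists>s. \<forall>j. 2 \<le> j \<longrightarrow> j < n \<longrightarrow> 0 < s * orient (P i) (P (Suc i)) (P (i + j))" for i
  proof -
    define e where "e = P (Suc i) - P i"
    define m where "m = midpoint (P i) (P (Suc i))"
    have "i mod n \<noteq> Suc i mod n" using n by (simp add: mod_Suc)
    then have e0: "e \<noteq> 0" using P_eq_iff by (simp add: e_def)
    have "m \<in> frontier C" using seg[of i] by (auto simp: m_def)
    then have "{m} \<inter> interior C = {}" by (auto simp: frontier_def)
    then obtain a b where a0: "a \<noteq> 0" and aC: "\<And>x. x \<in> C \<Longrightarrow> a \<bullet> x \<le> b" and am: "b \<le> a \<bullet> m"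
      using supporting_functional[OF convC int, of "{m}"] by auto
    have "a \<bullet> m = (a \<bullet> P i + a \<bullet> P (Suc i)) / 2"
      by (simp add: m_def midpoint_def inner_add_right)
    then have ab: "a \<bullet> P i = b" "a \<bullet> P (Suc i) = b"
      using am aC[OF PC[of i]] aC[OF PC[of "Suc i"]] by simp_all
    then have "a \<bullet> e = 0" by (simp add: e_def inner_diff_right)
    then obtain r where r: "a = r *\<^sub>R perp e" using orthogonal_perp_multiple e0 by blast
    have "0 < (- r) * orient (P i) (P (Suc i)) (P (i + j))" if j: "2 \<le> j" "j < n" for j
    proof -
      have "r * orient (P i) (P (Suc i)) (P (i + j)) = a \<bullet> (P (i + j) - P i)"
        by (simp add: r perp_inner orient_def e_def)
      also have "\<dots> \<le> 0" using aC[OF PC[of "i + j"]] ab by (simp add: inner_diff_right)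
      finally have le: "r * orient (P i) (P (Suc i)) (P (i + j)) \<le> 0" .
      have ne: "(i + j) mod n \<noteq> i mod n" "(i + j) mod n \<noteq> Suc i mod n"
      proof -
        have "\<not> n dvd j" using j by (auto dest: dvd_imp_le)
        moreover have "\<not> n dvd (j - 1)" using j by (auto dest: dvd_imp_le)
        ultimately show "(i + j) mod n \<noteq> i mod n" "(i + j) mod n \<noteq> Suc i mod n"
          using j mod_eq_dvd_iff_nat[of "i" "i + j" n] mod_eq_dvd_iff_nat[of "Suc i" "i + j" n]
          by (auto simp: diff_diff_left)
      qed
      have "orient (P i) (P (Suc i)) (P (i + j)) \<noteq> 0"
      proof
        assume "orient (P i) (P (Suc i)) (P (i + j)) = 0"
        then have "P i \<in> open_segment (P (Suc i)) (P (i + j)) \<or>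
            P (Suc i) \<in> open_segment (P i) (P (i + j)) \<or>
            P (i + j) \<in> open_segment (P i) (P (Suc i))"
          using ne \<open>i mod n \<noteq> Suc i mod n\<close> by (intro orient_eq_0_cases) (auto simp: P_eq_iff)
        then show False using extreme PC unfolding extreme_point_of_def by blast
      qed
      moreover have "r \<noteq> 0" using a0 r by auto
      ultimately have "r * orient (P i) (P (Suc i)) (P (i + j)) \<noteq> 0" by simp
      then show ?thesis using le by linarith
    qed
    then show ?thesis by blast
  qed
  then obtain s where s: "\<And>i j. 2 \<le> j \<Longrightarrow> j < n \<Longrightarrow>
      0 < s i * orient (P i) (P (Suc i)) (P (i + j))" by metis
  have period: "P (k + n) = P k" for k by (simp add: P_def)
  have "0 < s 0 * orient (P i) (P (Suc i)) (P (i + j))" if "2 \<le> j" "j < n" for i j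
    using that
  proof (induction i arbitrary: j)
    case 0
    then show ?case by (rule s)
  next
    case (Suc i)
    have "0 < s 0 * orient (P i) (P (Suc i)) (P (i + 2))" using n Suc.IH[of 2] by simp
    moreover have "0 < s (Suc i) * orient (P (Suc i)) (P (Suc (Suc i))) (P (Suc i + (n - 1)))"
      using n by (intro s) auto
    moreover have "Suc i + (n - 1) = i + n" using n by simp
    ultimately have "0 < s 0 * orient (P i) (P (Suc i)) (P (i + 2))"
      "0 < s (Suc i) * orient (P i) (P (Suc i)) (P (i + 2))"
      by (simp_all add: period orient_rotate)
    then show ?case using same_sign_mult s Suc.prems by blast
  qed
  then have "ccw (s 0) n P" using period by (intro ccw_if_edges_support)
  then show ?thesis by (auto simp: ccw_def P_def)
qed

lemma ccw_edge:
  assumes "ccw s n P" "i < n" "j < n" "j \<noteq> i" "j \<noteq> Suc i mod n"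
  shows "0 < s * orient (P i) (P (Suc i mod n)) (P j)"
proof (cases "Suc i < n")
  case True
  then show ?thesis
  proof (cases "j < i")
    case True
    then have "0 < s * orient (P j) (P i) (P (Suc i))"
      using assms \<open>Suc i < n\<close> unfolding ccw_def by simp
    then show ?thesis using \<open>Suc i < n\<close> by (simp add: orient_rotate[of "P i" "P (Suc i)"])
  next
    case False
    then show ?thesis using assms \<open>Suc i < n\<close> unfolding ccw_def by simp
  qed
next
  case False
  then have "Suc i = n" using assms by simp
  then have "0 < j" "j < i" using assms by auto
  then have "0 < s * orient (P 0) (P j) (P i)" using assms unfolding ccw_def by blast
  then show ?thesis using \<open>Suc i = n\<close> by (simp add: orient_rotate[of "P 0" "P j"])
qed

lemma ccw_orient_nonzero:
  assumes "ccw s n P" "i < n" "j < n" "k < n" "i \<noteq> j" "i \<noteq> k" "j \<noteq> k"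
  shows "orient (P i) (P j) (P k) \<noteq> 0"
proof -
  have ord: "orient (P i) (P j) (P k) \<noteq> 0" if "i < j" "j < k" "k < n" for i j k
    using assms(1) that unfolding ccw_def by (metis less_irrefl mult_zero_right)
  show ?thesis
    using ord[of i j k] ord[of i k j] ord[of j i k] ord[of j k i] ord[of k i j] ord[of k j i] assms
    by (metis neqE orient_rotate orient_swap neg_equal_0_iff_equal)
qed

lemma ccw_distinct:
  assumes "ccw s n P" "n \<ge> 3" "i < n" "j < n" "i \<noteq> j"
  shows "P i \<noteq> P j"
proof -
  have "card ({..<n} - {i, j}) > 0" using assms by (simp add: card_Diff_subset)
  then obtain k where "k < n" "k \<noteq> i" "k \<noteq> j"
    by (metis Diff_iff card_gt_0_iff ex_in_conv insertCI lessThan_iff)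
  then show ?thesis using ccw_orient_nonzero[OF assms(1), of i j k] assms by auto
qed

text \<open>
  If \<open>P i\<close> and \<open>P j\<close> are not neighbours, there is a vertex between them and another one outside,
  and these two lie on different sides of the line through \<open>P i\<close> and \<open>P j\<close>.
\<close>
lemma ccw_line_touching_two_vertices:
  assumes P: "ccw s n P" and ij: "i < j" "j < n"
    and a: "a \<noteq> 0" "a \<bullet> P i = b" "a \<bullet> P j = b" "P i \<noteq> P j" and le: "\<And>k. k < n \<Longrightarrow> a \<bullet> P k \<le> b"
  shows "j = Suc i \<or> i = 0 \<and> Suc j = n"
proof (rule ccontr)
  assume not_adj: "\<not> ?thesis"
  \<comment> \<open>\<open>a\<close> is normal to the line, so it measures the orientation against \<open>P i\<close> and \<open>P j\<close>\<close>
  obtain r where r: "a = r *\<^sub>R perp (P j - P i)"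
    using orthogonal_perp_multiple[of a "P j - P i"] a by (auto simp: inner_diff_right)
  have side: "r * orient (P i) (P j) (P k) \<le> 0" if "k < n" for k
  proof -
    have "r * orient (P i) (P j) (P k) = a \<bullet> (P k - P i)"
      by (simp add: r perp_inner orient_def)
    then show ?thesis using le[OF that] a by (simp add: inner_diff_right)
  qed
  have "0 < s * orient (P i) (P (Suc i)) (P j)"
    using P ij not_adj unfolding ccw_def by auto
  then have between: "s * orient (P i) (P j) (P (Suc i)) < 0"
    by (simp add: orient_swap[of "P i" "P j"])
  obtain m where "m < n" and outside: "0 < s * orient (P i) (P j) (P m)"
  proof (cases "i = 0")
    case True
    then show ?thesis using P ij not_adj that[of "n - 1"] unfolding ccw_def by auto
  next
    case False
    then have "0 < s * orient (P 0) (P i) (P j)" using P ij unfolding ccw_def by auto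
    then show ?thesis using that[of 0] ij by (simp add: orient_rotate)
  qed
  have "r \<noteq> 0" using a r by auto
  then show False
    using between outside side[OF \<open>m < n\<close>] side[of "Suc i"] ij
    by (auto simp: mult_less_0_iff zero_less_mult_iff mult_le_0_iff)
qed

text \<open>
  A point of the frontier lies in the face of the hull cut out by a supporting line. This face
  is the hull of the vertices on the line, which are at most two since no three vertices are
  collinear, and then neighbours. At each vertex, the line parallel to the diagonal of its two
  neighbours meets the hull in that vertex only.
\<close>
lemma ccw_imp_strictly_convex_polygon:
  assumes n: "n \<ge> 3" and P': "ccw s n (\<lambda>k. p (Suc k))"
  shows "strictly_convex_polygon n p"
proof -
  define P where "P k = p (Suc k)" for k
  define C where "C = convex hull (p ` {1..n})"
  have P: "ccw s n P" using P' by (simp add: P_def[abs_def])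
  have range: "p ` {1..n} = P ` {..<n}"
  proof -
    have "{1..n} = Suc ` {..<n}" by (simp add: image_Suc_lessThan)
    then show ?thesis by (simp add: image_image P_def)
  qed
  have cyc: "p (cyc_next n (Suc i)) = P (Suc i mod n)" for i by (simp add: cyc_next_def P_def)
  have "s \<noteq> 0" using P n unfolding ccw_def
    by (metis less_irrefl lessI less_le_trans mult_zero_left numeral_3_eq_3)
  have convC: "convex C" and "compact C"
    by (simp_all add: C_def finite_imp_compact compact_convex_hull)
  then have frC: "frontier C = C - interior C"
    by (simp add: frontier_def closure_closed compact_imp_closed)
  have PC: "P k \<in> C" if "k < n" for k unfolding C_def range using that by (intro hull_inc) auto
  have face: "\<exists>S \<subseteq> P ` {..<n}. C \<inter> {x. a \<bullet> x = b} = convex hull S"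
    if "\<And>x. x \<in> C \<Longrightarrow> a \<bullet> x \<le> b" for a b
  proof -
    have "C \<inter> {x. a \<bullet> x = b} face_of convex hull (P ` {..<n})"
      using face_of_Int_supporting_hyperplane_le[OF convC that] by (simp only: C_def range)
    then show ?thesis
      using face_of_convex_hull_subset[of "P ` {..<n}"]
      by (metis finite_imageI finite_imp_compact finite_lessThan)
  qed
  have halfspace: "a \<bullet> x \<le> b" if "\<And>k. k < n \<Longrightarrow> a \<bullet> P k \<le> b" "x \<in> C" for a b x
  proof -
    have "C \<subseteq> {x. a \<bullet> x \<le> b}"
      unfolding C_def range using that by (intro hull_minimal convex_halfspace_le) auto
    then show ?thesis using that by auto
  qed
  have "inj_on p {1..n}"
    using ccw_distinct[OF P n]
    by (intro inj_onI) (metis P_def Suc_le_D Suc_le_lessD atLeastAtMost_iff One_nat_def)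
  moreover have int: "interior C \<noteq> {}"
  proof
    assume "interior C = {}"
    then obtain a b where a: "a \<noteq> 0" "C \<subseteq> {x. a \<bullet> x = b}"
      using empty_interior_subset_hyperplane convC by blast
    have eq: "a \<bullet> P 0 = b" "a \<bullet> P 1 = b" "a \<bullet> P 2 = b" using PC[of 0] PC[of 1] PC[of 2] n a by auto
    then obtain r where r: "a = r *\<^sub>R perp (P 1 - P 0)"
      using orthogonal_perp_multiple[of a "P 1 - P 0"] ccw_distinct[OF P n, of 0 1] n
      by (auto simp: inner_diff_right)
    have "r * orient (P 0) (P 1) (P 2) = a \<bullet> (P 2 - P 0)"
      by (simp add: r perp_inner orient_def)
    also have "\<dots> = 0" using eq by (simp add: inner_diff_right)
    finally show False using ccw_orient_nonzero[OF P, of 0 1 2] n r a by auto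
  qed
  moreover have "frontier C = (\<Union>i\<in>{1..n}. closed_segment (p i) (p (cyc_next n i)))"
  proof (intro equalityI subsetI)
    fix x assume x: "x \<in> frontier C"
    have "{x} \<inter> interior C = {}" using x frC by auto
    then obtain a b where a0: "a \<noteq> 0" and aC: "\<And>y. y \<in> C \<Longrightarrow> a \<bullet> y \<le> b" and "b \<le> a \<bullet> x"
      using supporting_functional[OF convC int, of "{x}"] by auto
    then have ax: "a \<bullet> x = b" "x \<in> C" using x frC by (auto intro: antisym)
    obtain S where S: "S \<subseteq> P ` {..<n}" "C \<inter> {x. a \<bullet> x = b} = convex hull S" using face[OF aC] by auto
    have xS: "x \<in> convex hull S" unfolding S(2)[symmetric] using ax by simp
    have Sb: "a \<bullet> y = b" if "y \<in> S" for y
      using hull_inc[OF that, of convex] unfolding S(2)[symmetric] by simp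
    have S2: "x \<in> (\<Union>i\<in>{1..n}. closed_segment (p i) (p (cyc_next n i)))"
      if ij: "i < j" "j < n" "P i \<in> S" "P j \<in> S" for i j
    proof -
      have ne: "P i \<noteq> P j" using ccw_distinct[OF P n] ij by auto
      obtain r where r: "a = r *\<^sub>R perp (P j - P i)"
        using orthogonal_perp_multiple[of a "P j - P i"] Sb ij ne by (auto simp: inner_diff_right)
      have "S \<subseteq> {P i, P j}"
      proof (rule ccontr)
        assume "\<not> ?thesis"
        then obtain k where k: "k < n" "P k \<in> S" "k \<noteq> i" "k \<noteq> j" using S by auto
        have "r * orient (P i) (P j) (P k) = a \<bullet> (P k - P i)"
          by (simp add: r perp_inner orient_def)
        also have "\<dots> = 0" using Sb ij k by (simp add: inner_diff_right)
        finally show False using ccw_orient_nonzero[OF P, of i j k] ij k r a0 by auto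
      qed
      then have "x \<in> closed_segment (P i) (P j)"
        using xS hull_mono[of S "{P i, P j}" convex] by (auto simp: segment_convex_hull)
      moreover have "j = Suc i \<or> i = 0 \<and> Suc j = n"
        using ccw_line_touching_two_vertices[OF P ij(1,2) a0] Sb ij ne aC PC by auto
      ultimately show ?thesis
      proof (elim disjE)
        assume "x \<in> closed_segment (P i) (P j)" "j = Suc i"
        then have "x \<in> closed_segment (p (Suc i)) (p (cyc_next n (Suc i)))"
          using ij cyc by (simp add: P_def)
        then show ?thesis using ij by (intro UN_I[of "Suc i"]) auto
      next
        assume "x \<in> closed_segment (P i) (P j)" "i = 0 \<and> Suc j = n"
        then have "x \<in> closed_segment (p (Suc j)) (p (cyc_next n (Suc j)))"
          using cyc[of j] by (simp add: P_def closed_segment_commute)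
        then show ?thesis using ij by (intro UN_I[of "Suc j"]) auto
      qed
    qed
    have "S \<noteq> {}" using xS by auto
    then obtain i where i: "i < n" "P i \<in> S" using S(1) by auto
    show "x \<in> (\<Union>i\<in>{1..n}. closed_segment (p i) (p (cyc_next n i)))"
    proof (cases "\<exists>j<n. j \<noteq> i \<and> P j \<in> S")
      case True
      then show ?thesis using S2 i by (metis nat_neq_iff)
    next
      case False
      then have "S \<subseteq> {P i}" using S by auto
      then have "x \<in> convex hull {P i}" using xS hull_mono by blast
      then show ?thesis using i by (intro UN_I[of "Suc i"]) (auto simp: P_def)
    qed
  next
    fix x assume "x \<in> (\<Union>i\<in>{1..n}. closed_segment (p i) (p (cyc_next n i)))"
    then obtain i' where i': "i' \<in> {1..n}" "x \<in> closed_segment (p i') (p (cyc_next n i'))" by blast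
    define i where "i = i' - 1"
    have i: "i < n" "x \<in> closed_segment (P i) (P (Suc i mod n))"
      using i' cyc[of i] by (auto simp: i_def P_def)
    define e where "e = P (Suc i mod n) - P i"
    define a where "a = (- s) *\<^sub>R perp e"
    have "Suc i mod n \<noteq> i" using n i by (simp add: mod_Suc)
    then have "e \<noteq> 0" using ccw_distinct[OF P n, of i "Suc i mod n"] i by (auto simp: e_def)
    then have "a \<noteq> 0" using \<open>s \<noteq> 0\<close> by (simp add: a_def)
    have a_diff: "a \<bullet> (y - P i) = - (s * orient (P i) (P (Suc i mod n)) y)" for y
      by (simp add: a_def perp_inner e_def orient_def)
    have "a \<bullet> P k \<le> a \<bullet> P i" if "k < n" for k
      using ccw_edge[OF P i(1) that] a_diff[of "P k"]
      by (cases "k = i \<or> k = Suc i mod n") (auto simp: inner_diff_right)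
    then have "C \<subseteq> {y. a \<bullet> y \<le> a \<bullet> P i}" using halfspace by blast
    then have "interior C \<subseteq> {y. a \<bullet> y < a \<bullet> P i}"
      using interior_mono interior_halfspace_le[OF \<open>a \<noteq> 0\<close>] by blast
    moreover have "a \<bullet> x = a \<bullet> P i"
    proof -
      obtain u where "x = (1 - u) *\<^sub>R P i + u *\<^sub>R P (Suc i mod n)"
        using i by (auto simp: in_segment)
      then have "x - P i = u *\<^sub>R e" by (simp add: e_def algebra_simps)
      then have "a \<bullet> (x - P i) = 0" by (simp add: a_def perp_inner cross2_bilinear)
      then show ?thesis by (simp add: inner_diff_right)
    qed
    moreover have "x \<in> C"
      using i PC convC convex_contains_segment[of C] n
      by (meson mod_less_divisor less_le_trans zero_less_numeral subsetD)
    ultimately show "x \<in> frontier C" using frC by auto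
  qed
  moreover have "\<exists>L. affine L \<and> aff_dim L = 1 \<and> L \<inter> C = {p i'}" if i': "i' \<in> {1..n}" for i'
  proof -
    define i where "i = i' - 1"
    have i: "i < n" "p i' = P i" using i' by (auto simp: i_def P_def)
    define h where "h = (i + (n - 1)) mod n"
    have h: "h < n" "h \<noteq> i" "Suc h mod n = i"
      using i n by (auto simp: h_def mod_Suc_eq mod_if)
    define j where "j = Suc i mod n"
    have j: "j < n" "j \<noteq> i" "j \<noteq> h" using i n by (auto simp: j_def h_def mod_if)
    \<comment> \<open>the functional whose level line at \<open>P i\<close> is parallel to the diagonal
      of its neighbours \<open>P h\<close> and \<open>P j\<close>\<close>
    define a where "a = (- s) *\<^sub>R perp (P j - P h)"
    have a_diff: "a \<bullet> (y - P i)
        = - (s * orient (P h) (P i) y) - s * orient (P i) (P j) y" for y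
      by (simp add: a_def perp_inner orient_def cross2_def algebra_simps)
    have a_less: "a \<bullet> P k < a \<bullet> P i" if k: "k < n" "k \<noteq> i" for k
    proof -
      have 1: "0 < s * orient (P h) (P i) (P k)" if "k \<noteq> h"
        using ccw_edge[OF P h(1) k(1)] h k that by simp
      have 2: "0 < s * orient (P i) (P j) (P k)" if "k \<noteq> j"
        using ccw_edge[OF P i(1) k(1)] k that by (simp add: j_def)
      have "a \<bullet> (P k - P i) < 0"
        unfolding a_diff using 1 2 j by (cases "k = h"; cases "k = j") auto
      then show ?thesis by (simp add: inner_diff_right)
    qed
    have "P j \<noteq> P h" using ccw_distinct[OF P n] j h by simp
    then have "a \<noteq> 0" using \<open>s \<noteq> 0\<close> by (simp add: a_def)
    have "a \<bullet> x \<le> a \<bullet> P i" if "x \<in> C" for x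
      using halfspace[OF _ that] a_less by (metis less_imp_le order_refl)
    then obtain S where S: "S \<subseteq> P ` {..<n}" "C \<inter> {x. a \<bullet> x = a \<bullet> P i} = convex hull S"
      using face[of a "a \<bullet> P i"] by auto
    have "S \<subseteq> {P i}"
    proof
      fix y assume y: "y \<in> S"
      then have "a \<bullet> y = a \<bullet> P i"
        using hull_inc[OF y, of convex] unfolding S(2)[symmetric] by simp
      then show "y \<in> {P i}" using S(1) y a_less by force
    qed
    moreover have "P i \<in> convex hull S" unfolding S(2)[symmetric] using PC i by simp
    ultimately have "convex hull S = {P i}"
      by (metis convex_hull_singleton convex_hull_empty empty_iff subset_singletonD)
    then have "{x. a \<bullet> x = a \<bullet> P i} \<inter> C = {p i'}" using S(2) i by (simp add: Int_commute)
    then show ?thesis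
      using affine_hyperplane aff_dim_hyperplane[OF \<open>a \<noteq> 0\<close>]
      by (intro exI[of _ "{x. a \<bullet> x = a \<bullet> P i}"]) auto
  qed
  ultimately show ?thesis unfolding strictly_convex_polygon_def C_def by blast
qed

section \<open>Polar coordinates and rotations\<close>

text \<open>
  Angles are real numbers, not residues modulo a full turn; this is what makes it possible to
  compare and to average them.
\<close>
definition polar :: "real \<Rightarrow> real \<Rightarrow> real ^ 2" where
  "polar l t = vector [l * cos t, l * sin t]"

definition rot :: "real \<Rightarrow> real ^ 2 \<Rightarrow> real ^ 2" where
  "rot c x = cos c *\<^sub>R x + sin c *\<^sub>R perp x"

lemma perp_linear: "perp (x + y) = perp x + perp y" "perp (x - y) = perp x - perp y"
  "perp (r *\<^sub>R x) = r *\<^sub>R perp x"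
  by (simp_all add: perp_def vec2_eq_iff)

lemma rot_diff: "rot c (x - y) = rot c x - rot c y"
  by (simp add: rot_def perp_linear algebra_simps)

lemma norm_2_power2: "(norm (x :: real ^ 2))\<^sup>2 = (x $ 1)\<^sup>2 + (x $ 2)\<^sup>2"
  unfolding power2_norm_eq_inner inner_2 by (simp add: power2_eq_square)

lemma norm_rot [simp]: "norm (rot c x) = norm x"
proof -
  have "(norm (rot c x))\<^sup>2
      = (cos c * x $ 1 - sin c * x $ 2)\<^sup>2 + (cos c * x $ 2 + sin c * x $ 1)\<^sup>2"
    unfolding norm_2_power2 by (simp add: rot_def perp_def)
  also have "\<dots> = ((cos c)\<^sup>2 + (sin c)\<^sup>2) * ((x $ 1)\<^sup>2 + (x $ 2)\<^sup>2)" by algebra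
  also have "\<dots> = (norm x)\<^sup>2" by (simp add: norm_2_power2)
  finally show ?thesis by (simp add: power2_eq_iff_nonneg)
qed

lemma rot_rot: "rot a (rot b x) = rot (a + b) x"
  by (simp add: rot_def perp_def vec2_eq_iff cos_add sin_add algebra_simps)

lemma rot_0 [simp]: "rot 0 x = x"
  by (simp add: rot_def)

lemma rot_polar: "rot c (polar l t) = polar l (t + c)"
  by (simp add: rot_def polar_def perp_def vec2_eq_iff cos_add sin_add algebra_simps)

lemma cross2_polar: "cross2 (polar l t) (polar m u) = l * m * sin (u - t)"
  by (simp add: cross2_def polar_def sin_diff algebra_simps)

text \<open>
  The sum of two vectors of the same length points along the bisecting direction. With angles
  less than \<open>2 * pi\<close> apart, but more than \<open>pi\<close>, the cosine is negative and the sum has the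
  opposite direction; this is why the averaging below needs angles less than \<open>pi\<close> apart.
\<close>
lemma polar_add_polar:
  "polar l t + polar l u = polar (2 * l * cos ((t - u) / 2)) ((t + u) / 2)"
  using cos_plus_cos[of t u] sin_plus_sin[of t u]
  by (simp add: polar_def vec2_eq_iff algebra_simps flip: distrib_left)

lemma polar_exists:
  obtains t where "a \<le> t" "t < a + 2 * pi" "x = polar (norm x) t"
proof (cases "x = 0")
  case True
  then show ?thesis using that[of a] by (simp add: polar_def vec2_eq_iff)
next
  case False
  \<comment> \<open>rotating by \<open>- a\<close> moves the interval of angles to the standard one from \<open>0\<close> to \<open>2 * pi\<close>\<close>
  define y where "y = (1 / norm x) *\<^sub>R rot (- a) x"
  have "(norm y)\<^sup>2 = 1" using False by (simp add: y_def)
  then obtain t where t: "0 \<le> t" "t < 2 * pi" "y $ 1 = cos t" "y $ 2 = sin t"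
    using sincos_total_2pi[of "y $ 1" "y $ 2"] by (auto simp: norm_2_power2)
  have "x = rot a (rot (- a) x)" by (simp add: rot_rot)
  also have "rot (- a) x = norm x *\<^sub>R y" using False by (simp add: y_def)
  also have "\<dots> = polar (norm x) t" using t by (simp add: polar_def vec2_eq_iff)
  also have "rot a (polar (norm x) t) = polar (norm x) (a + t)" by (simp add: rot_polar add.commute)
  finally show ?thesis using that[of "a + t"] t by simp
qed

section \<open>The angles of the edges of a convex polygon\<close>

text \<open>
  Measured from the line of the first edge, the heights of the vertices of a convex polygon have
  no local minimum apart from that edge: at such a minimum \<open>P (Suc k)\<close>, the lower vertex \<open>P 0\<close>
  would lie in the cone spanned by the two neighbours, which are at least as high.
\<close>
lemma ccw_descending_edges:
  assumes P: "ccw 1 n P" and k: "1 \<le> k" "Suc k < n"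
    and down: "cross2 (P 1 - P 0) (P (Suc k) - P k) < 0"
  shows "cross2 (P 1 - P 0) (P (Suc (Suc k) mod n) - P (Suc k)) < 0"
proof (cases "Suc (Suc k) < n")
  case False
  then have "Suc (Suc k) mod n = 0" using k by (simp add: not_less le_Suc_eq)
  moreover have "0 < orient (P 0) (P 1) (P (Suc k))"
    using P k unfolding ccw_def by (metis One_nat_def less_Suc_eq_le mult_1 zero_less_one)
  ultimately show ?thesis by (simp add: orient_def cross2_bilinear)
next
  case True
  define e a b c where "e = P 1 - P 0" and "a = P (Suc (Suc k)) - P (Suc k)"
    and "b = P 0 - P (Suc k)" and "c = P k - P (Suc k)"
  have pos: "0 < orient (P i) (P j) (P l)" if "i < j" "j < l" "l < n" for i j l
    using P that unfolding ccw_def by (metis mult_1)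
  have "0 < cross2 a c"
    using pos[of k "Suc k" "Suc (Suc k)"] True k
    by (simp add: a_def c_def orient_def cross2_def algebra_simps)
  moreover have "0 < cross2 b c"
    using pos[of 0 k "Suc k"] k
    by (simp add: b_def c_def orient_def cross2_def algebra_simps)
  moreover have "0 < cross2 a b"
    using pos[of 0 "Suc k" "Suc (Suc k)"] True
    by (simp add: a_def b_def orient_def cross2_def algebra_simps)
  moreover have "cross2 e b < 0"
    using pos[of 0 1 "Suc k"] k by (simp add: e_def b_def orient_def cross2_def algebra_simps)
  moreover have "0 < cross2 e c" using down by (simp add: e_def c_def cross2_bilinear)
  ultimately have "cross2 e a * cross2 b c < 0"
    using cross2_plucker[of e b a c] mult_neg_pos[of "cross2 e b" "cross2 a c"]
      mult_pos_pos[of "cross2 e c" "cross2 a b"] by linarith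
  then have "cross2 e a < 0" using \<open>0 < cross2 b c\<close> by (simp add: mult_less_0_iff)
  then show ?thesis using True by (simp add: e_def a_def)
qed

definition edge :: "nat \<Rightarrow> (nat \<Rightarrow> real ^ 2) \<Rightarrow> nat \<Rightarrow> real ^ 2" where
  "edge n P k = P (Suc k mod n) - P k"

text \<open>
  The edges of a convex polygon turn once around: choosing all angles in the full turn that
  begins at the first edge, they increase. A left turn at a vertex leaves only one way for the
  angle to drop, namely from the descending half of the turn to the ascending half, and this is
  impossible because heights do not rise again once they have begun to fall.
\<close>
lemma ccw_edge_angles:
  assumes n: "n \<ge> 3" and P: "ccw 1 n P"
  obtains \<theta> where "\<And>k. k < n \<Longrightarrow> edge n P k = polar (norm (edge n P k)) (\<theta> k)"
    and "\<And>j k. j < k \<Longrightarrow> k < n \<Longrightarrow> \<theta> j < \<theta> k"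
    and "\<And>k. k < n \<Longrightarrow> \<theta> k < \<theta> 0 + 2 * pi"
proof -
  let ?E = "edge n P"
  obtain \<alpha> where \<alpha>: "?E 0 = polar (norm (?E 0)) \<alpha>" using polar_exists by blast
  have "\<exists>t. \<alpha> \<le> t \<and> t < \<alpha> + 2 * pi \<and> ?E k = polar (norm (?E k)) t \<and> (k = 0 \<longrightarrow> t = \<alpha>)" for k
    using \<alpha> polar_exists[of \<alpha> "?E k"] by (cases "k = 0") auto
  then obtain \<theta> where \<theta>: "\<And>k. \<alpha> \<le> \<theta> k" "\<And>k. \<theta> k < \<alpha> + 2 * pi"
    "\<And>k. ?E k = polar (norm (?E k)) (\<theta> k)" and \<theta>0: "\<theta> 0 = \<alpha>" by metis
  have E_pos: "0 < norm (?E k)" if "k < n" for k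
    using ccw_distinct[OF P n, of "Suc k mod n" k] that n by (auto simp: edge_def mod_Suc)
  have cross: "cross2 (?E j) (?E k) = norm (?E j) * norm (?E k) * sin (\<theta> k - \<theta> j)" for j k
    by (metis \<theta>(3) cross2_polar)
  have step: "\<theta> k < \<theta> (Suc k)" if k: "Suc k < n" for k
  proof (rule ccontr)
    assume neg: "\<not> ?thesis"
    have "0 < 1 * orient (P k) (P (Suc k mod n)) (P (Suc (Suc k) mod n))"
      using k n by (intro ccw_edge[OF P]) (auto simp: mod_Suc)
    then have "0 < cross2 (?E k) (?E (Suc k))"
      using k by (simp add: edge_def orient_def cross2_def algebra_simps)
    then have "0 < sin (\<theta> (Suc k) - \<theta> k)"
      unfolding cross using mult_pos_pos[OF E_pos E_pos, of k "Suc k"] k zero_less_mult_pos by auto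
    then have "sin (\<theta> k - \<theta> (Suc k)) < 0"
      using sin_minus[of "\<theta> k - \<theta> (Suc k)"] unfolding minus_diff_eq by linarith
    moreover have "0 \<le> \<theta> k - \<theta> (Suc k)" using neg by simp
    ultimately have "pi < \<theta> k - \<theta> (Suc k)" using sin_ge_zero by (meson not_le)
    then have *: "pi < \<theta> k - \<alpha>" "\<theta> k - \<alpha> < 2 * pi" "0 \<le> \<theta> (Suc k) - \<alpha>" "\<theta> (Suc k) - \<alpha> < pi"
      using \<theta>(1)[of k] \<theta>(2)[of k] \<theta>(1)[of "Suc k"] by linarith+
    then have "k \<noteq> 0" using \<theta>0 pi_gt_zero by (cases "k = 0") auto
    have "cross2 (?E 0) (?E k) < 0"
      unfolding cross \<theta>0 using E_pos k n * sin_lt_zero[of "\<theta> k - \<alpha>"]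
      by (simp add: mult_less_0_iff zero_less_mult_iff)
    moreover have "0 \<le> cross2 (?E 0) (?E (Suc k))"
      unfolding cross \<theta>0 using * sin_ge_zero[of "\<theta> (Suc k) - \<alpha>"] by simp
    ultimately show False
      using ccw_descending_edges[OF P, of k] k \<open>k \<noteq> 0\<close> n by (simp add: edge_def)
  qed
  have mono: "\<theta> j < \<theta> k" if "j < k" "k < n" for j k
    using Suc_leI[OF that(1)] that(2)
  proof (induction k rule: dec_induct)
    case base
    then show ?case by (rule step)
  next
    case (step k)
    then show ?case using \<open>\<And>k. Suc k < n \<Longrightarrow> \<theta> k < \<theta> (Suc k)\<close>[of k] by simp
  qed
  show ?thesis using that[of \<theta>] \<theta> \<theta>0 mono by simp
qed

text \<open>
  The converse: a closed polygon whose edge angles increase within one full turn is convex. Along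
  edge \<open>k\<close>, the height above the line of edge \<open>i\<close> changes by a positive multiple of
  \<open>sin (\<Psi> k - \<Psi> i)\<close>. So the heights first rise and then fall, with at most one level edge in
  between, and since they return to 0 they are positive at all vertices off edge \<open>i\<close>. The angles
  are continued to all indices by adding \<open>2 * pi\<close> for every turn, so that the argument is the
  same at each edge.
\<close>
lemma ccw_if_edge_angles_increase:
  assumes n: "n \<ge> 3"
    and edge: "\<And>k. k < n \<Longrightarrow> edge n P k = polar (m k) (\<psi> k)"
    and m: "\<And>k. k < n \<Longrightarrow> 0 < m k"
    and mono: "\<And>j k. j < k \<Longrightarrow> k < n \<Longrightarrow> \<psi> j < \<psi> k"
    and less: "\<And>k. k < n \<Longrightarrow> \<psi> k < \<psi> 0 + 2 * pi"
  shows "ccw 1 n P"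
proof -
  define Q where "Q k = P (k mod n)" for k
  define M where "M k = m (k mod n)" for k
  define \<Psi> where "\<Psi> k = \<psi> (k mod n) + 2 * pi * real (k div n)" for k
  have period: "Q (k + n) = Q k" for k by (simp add: Q_def)
  have M: "0 < M k" for k using m n by (simp add: M_def)
  have QE: "Q (Suc k) - Q k = polar (M k) (\<Psi> k)" for k
  proof -
    have "Q (Suc k) - Q k = polar (m (k mod n)) (\<psi> (k mod n))"
      using edge[of "k mod n"] n by (simp add: Q_def edge_def mod_Suc_eq)
    moreover have "cos (x + 2 * pi * real r) = cos x" "sin (x + 2 * pi * real r) = sin x" for x r
      using cos_int_2pin[of "int r"] sin_int_2pin[of "int r"] by (simp_all add: cos_add sin_add)
    ultimately show ?thesis by (simp add: M_def \<Psi>_def polar_def)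
  qed
  have "\<Psi> k < \<Psi> (Suc k)" for k
  proof (cases "Suc (k mod n) = n")
    case True
    then show ?thesis using less[of "k mod n"] n by (simp add: \<Psi>_def mod_Suc div_Suc algebra_simps)
  next
    case False
    then have "Suc (k mod n) < n" using n by (simp add: Suc_lessI)
    then show ?thesis using mono[of "k mod n" "Suc (k mod n)"] False
      by (simp add: \<Psi>_def mod_Suc div_Suc)
  qed
  then have \<Psi>_mono: "\<Psi> j < \<Psi> k" if "j < k" for j k using lift_Suc_mono_less that by blast
  have \<Psi>_period: "\<Psi> (k + n) = \<Psi> k + 2 * pi" for k
    using n by (simp add: \<Psi>_def algebra_simps)
  have "0 < 1 * orient (Q i) (Q (Suc i)) (Q (i + j))" if j: "2 \<le> j" "j < n" for i j
  proof -
    define e where "e = Q (Suc i) - Q i"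
    define f where "f k = M i * M (i + k) * sin (\<Psi> (i + k) - \<Psi> i)" for k
    have f: "cross2 e (Q (i + Suc k)) - cross2 e (Q (i + k)) = f k" for k
      using QE[of i] QE[of "i + k"] by (simp add: f_def e_def flip: cross2_bilinear cross2_polar)
    have sum: "(\<Sum>k=a..<b. f k) = cross2 e (Q (i + b)) - cross2 e (Q (i + a))" if "a \<le> b" for a b
      unfolding f[symmetric] using that by (rule sum_Suc_diff')
    \<comment> \<open>if the height still rises on the edge into \<open>Q (i + j)\<close>, sum the increments from the start;
      otherwise it falls on all edges from there to the end, where the height is 0\<close>
    show ?thesis
    proof (cases "\<Psi> (i + (j - 1)) - \<Psi> i < pi")
      case True
      have "0 < f k" if "k \<in> {1..<j}" for k
      proof -
        have "k = j - 1 \<or> i + k < i + (j - 1)" using that by auto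
        then have "\<Psi> (i + k) \<le> \<Psi> (i + (j - 1))"
          using \<Psi>_mono[of "i + k" "i + (j - 1)"] by auto
        then have "0 < sin (\<Psi> (i + k) - \<Psi> i)"
          using True \<Psi>_mono[of i "i + k"] that by (intro sin_gt_zero) auto
        then show ?thesis using M by (simp add: f_def)
      qed
      then have "0 < (\<Sum>k=1..<j. f k)" using j by (intro sum_pos) auto
      also have "\<dots> = orient (Q i) (Q (Suc i)) (Q (i + j))"
        using sum[of 1 j] j by (simp add: orient_def e_def cross2_def algebra_simps)
      finally show ?thesis by simp
    next
      case False
      have "0 < - f k" if "k \<in> {j..<n}" for k
      proof -
        have "i + (j - 1) < i + k" using that j by auto
        then have "sin (\<Psi> (i + k) - \<Psi> i) < 0"
          using False \<Psi>_mono[of "i + (j - 1)" "i + k"] \<Psi>_mono[of "i + k" "i + n"] \<Psi>_period[of i] that j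
          by (intro sin_lt_zero) auto
        then show ?thesis using M by (simp add: f_def mult_pos_neg)
      qed
      then have "0 < (\<Sum>k=j..<n. - f k)" using j by (intro sum_pos) auto
      also have "\<dots> = orient (Q i) (Q (Suc i)) (Q (i + j))"
        using sum[of j n] j period[of i]
        by (simp add: orient_def e_def cross2_def sum_negf algebra_simps)
      finally show ?thesis by simp
    qed
  qed
  then have "ccw 1 n Q" using period by (intro ccw_if_edges_support)
  then show ?thesis by (simp add: ccw_def Q_def)
qed

text \<open>
  The heart of the passage from infinitesimal to convex rigidity. For increasing angle sequences
  \<open>\<theta>\<close> and \<open>\<phi>\<close>, each within one full turn, any two values of \<open>\<theta> - \<phi>\<close> differ by less than \<open>2 * pi\<close>.
  After rotating \<open>Q\<close> by the midpoint \<open>c\<close> of the range of \<open>\<theta> - \<phi>\<close>, the angles of corresponding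
  edges differ by less than \<open>pi\<close>. As these edges also have equal lengths, the edges of the sum
  have the averaged angles, which again increase within one full turn.
\<close>
lemma ccw_average:
  assumes n: "n \<ge> 3" and P: "ccw 1 n P" and Q: "ccw 1 n Q"
    and len: "\<And>k. k < n \<Longrightarrow> norm (edge n P k) = norm (edge n Q k)"
  obtains c where "ccw 1 n (\<lambda>k. P k + rot c (Q k))"
proof -
  obtain \<theta> where \<theta>: "\<And>k. k < n \<Longrightarrow> edge n P k = polar (norm (edge n P k)) (\<theta> k)"
    "\<And>j k. j < k \<Longrightarrow> k < n \<Longrightarrow> \<theta> j < \<theta> k" "\<And>k. k < n \<Longrightarrow> \<theta> k < \<theta> 0 + 2 * pi"
    using ccw_edge_angles[OF n P] by metis
  obtain \<phi> where \<phi>: "\<And>k. k < n \<Longrightarrow> edge n Q k = polar (norm (edge n Q k)) (\<phi> k)"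
    "\<And>j k. j < k \<Longrightarrow> k < n \<Longrightarrow> \<phi> j < \<phi> k" "\<And>k. k < n \<Longrightarrow> \<phi> k < \<phi> 0 + 2 * pi"
    using ccw_edge_angles[OF n Q] by metis
  define \<delta> where "\<delta> k = \<theta> k - \<phi> k" for k
  have osc: "\<delta> a - \<delta> b < 2 * pi" if "a < n" "b < n" for a b
  proof -
    \<comment> \<open>for \<open>a < b\<close> the angle \<open>\<theta>\<close> increases and \<open>\<phi>\<close> gains less than a full turn;
      otherwise vice versa\<close>
    have "\<theta> 0 \<le> \<theta> b" "\<phi> 0 \<le> \<phi> a"
      using \<theta>(2)[of 0 b] \<phi>(2)[of 0 a] that by (cases "b = 0", auto) (cases "a = 0", auto)
    then have "\<theta> a < \<theta> b + 2 * pi" "\<phi> b < \<phi> a + 2 * pi"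
      using \<theta>(3)[of a] \<phi>(3)[of b] that by auto
    then show ?thesis
      using \<theta>(2)[of a b] \<phi>(2)[of b a] that by (cases a b rule: linorder_cases) (auto simp: \<delta>_def)
  qed
  define c where "c = (Max (\<delta> ` {..<n}) + Min (\<delta> ` {..<n})) / 2"
  have near: "\<bar>\<delta> k - c\<bar> < pi" if "k < n" for k
  proof -
    have fin: "finite (\<delta> ` {..<n})" "\<delta> ` {..<n} \<noteq> {}" using n by (auto simp: lessThan_empty_iff bot_nat_def)
    obtain a b where "a < n" "Max (\<delta> ` {..<n}) = \<delta> a" "b < n" "Min (\<delta> ` {..<n}) = \<delta> b"
      using Max_in[OF fin] Min_in[OF fin] by auto
    moreover have "\<delta> k \<le> Max (\<delta> ` {..<n})" "Min (\<delta> ` {..<n}) \<le> \<delta> k" using fin that by auto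
    ultimately show ?thesis using osc[of a b] by (simp add: c_def abs_less_iff field_simps)
  qed
  define m where "m k = 2 * norm (edge n P k) * cos ((\<theta> k - (\<phi> k + c)) / 2)" for k
  define \<psi> where "\<psi> k = (\<theta> k + (\<phi> k + c)) / 2" for k
  have "ccw 1 n (\<lambda>k. P k + rot c (Q k))"
  proof (rule ccw_if_edge_angles_increase[OF n, where m = m and \<psi> = \<psi>])
    fix k assume k: "k < n"
    have "edge n (\<lambda>k. P k + rot c (Q k)) k = edge n P k + rot c (edge n Q k)"
      by (simp add: edge_def rot_diff)
    also have "edge n P k = polar (norm (edge n P k)) (\<theta> k)" using \<theta>(1) k .
    also have "rot c (edge n Q k) = polar (norm (edge n P k)) (\<phi> k + c)"
      using \<phi>(1)[OF k] len[OF k] by (metis rot_polar)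
    finally show "edge n (\<lambda>k. P k + rot c (Q k)) k = polar (m k) (\<psi> k)"
      by (simp add: polar_add_polar m_def \<psi>_def)
    have "0 < cos ((\<theta> k - (\<phi> k + c)) / 2)"
      using near[OF k] by (intro cos_gt_zero_pi) (auto simp: \<delta>_def abs_less_iff)
    moreover have "edge n P k \<noteq> 0"
      using ccw_distinct[OF P n, of "Suc k mod n" k] k n by (auto simp: edge_def mod_Suc)
    ultimately show "0 < m k" by (simp add: m_def)
    show "\<psi> k < \<psi> 0 + 2 * pi" using \<theta>(3)[OF k] \<phi>(3)[OF k] by (simp add: \<psi>_def field_simps)
    show "\<psi> j < \<psi> k" if "j < k" for j using \<theta>(2)[OF that k] \<phi>(2)[OF that k] by (simp add: \<psi>_def)
  qed
  then show ?thesis by (rule that)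
qed

section \<open>Trivial infinitesimal flexes of the plane\<close>

text \<open>
  Differentiate the constant squared distance of the two moving points.
\<close>
lemma trivial_flex_imp_orthogonal:
  fixes p p' :: "nat \<Rightarrow> real ^ 'd"
  assumes "trivial_flex n p p'" "i \<in> {1..n}" "j \<in> {1..n}"
  shows "(p i - p j) \<bullet> (p' i - p' j) = 0"
proof -
  obtain \<Phi> where \<Phi>: "smooth_congruence_family \<Phi>" "\<Phi> 0 = id"
    and deriv: "\<And>i. i \<in> {1..n} \<Longrightarrow> ((\<lambda>t. \<Phi> t (p i)) has_vector_derivative p' i) (at 0)"
    using assms(1) unfolding trivial_flex_def by blast
  define g where "g t = \<Phi> t (p i) - \<Phi> t (p j)" for t
  have g0: "g 0 = p i - p j" by (simp add: g_def \<Phi>)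
  have g: "(g has_vector_derivative (p' i - p' j)) (at 0)"
    unfolding g_def by (intro has_vector_derivative_diff deriv assms)
  have "((\<lambda>t. g t \<bullet> g t) has_vector_derivative (g 0 \<bullet> (p' i - p' j) + (p' i - p' j) \<bullet> g 0)) (at 0)"
    by (rule bounded_bilinear.has_vector_derivative[OF bounded_bilinear_inner g g])
  moreover have "(\<lambda>t. g t \<bullet> g t) = (\<lambda>t. (dist (p i) (p j))\<^sup>2)"
  proof
    fix t
    have "dist (\<Phi> t (p i)) (\<Phi> t (p j)) = dist (p i) (p j)"
      using \<Phi>(1) by (simp add: smooth_congruence_family_def is_congruence_def)
    then show "g t \<bullet> g t = (dist (p i) (p j))\<^sup>2"
      by (simp add: g_def dist_norm flip: power2_norm_eq_inner)
  qed
  ultimately have "((\<lambda>t :: real. (dist (p i) (p j))\<^sup>2) has_vector_derivative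
      (g 0 \<bullet> (p' i - p' j) + (p' i - p' j) \<bullet> g 0)) (at 0)" by simp
  then have "g 0 \<bullet> (p' i - p' j) + (p' i - p' j) \<bullet> g 0 = 0"
    using has_vector_derivative_const vector_derivative_unique_at by blast
  then show ?thesis by (simp add: g0 inner_commute)
qed

lemma rot_has_vector_derivative:
  "((\<lambda>t. rot (w * t + c) x) has_vector_derivative w *\<^sub>R rot (w * t + (c + pi / 2)) x) (at t)"
proof -
  have "((\<lambda>t. rot (w * t + c) x) has_vector_derivative
      ((- sin (w * t + c) * w) *\<^sub>R x + (cos (w * t + c) * w) *\<^sub>R perp x)) (at t)"
    unfolding rot_def
    by (auto intro!: derivative_eq_intros)
  moreover have "(- sin (w * t + c) * w) *\<^sub>R x + (cos (w * t + c) * w) *\<^sub>R perp x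
      = w *\<^sub>R rot (w * t + (c + pi / 2)) x"
    by (simp add: rot_def cos_add sin_add algebra_simps)
  ultimately show ?thesis by simp
qed

text \<open>
  A rotation about \<open>a\<close> at constant speed \<open>w\<close>, followed by a translation along \<open>v\<close>. A derivative
  of a rotation is the rotation advanced by a quarter turn, so all derivatives are explicit.
\<close>
lemma smooth_congruence_family_rotation_translation:
  "smooth_congruence_family (\<lambda>t x. a + t *\<^sub>R v + rot (w * t) (x - a))"
  unfolding smooth_congruence_family_def
proof (intro conjI allI)
  fix t
  show "is_congruence (\<lambda>x. a + t *\<^sub>R v + rot (w * t) (x - a))"
    by (simp add: is_congruence_def dist_norm flip: rot_diff)
next
  fix x
  define D where "D k t = (if k = 0 then a + t *\<^sub>R v else if k = 1 then v else 0)
    + w ^ k *\<^sub>R rot (w * t + real k * (pi / 2)) (x - a)" for k :: nat and t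
  have "(D k has_vector_derivative D (Suc k) t) (at t)" for k t
  proof -
    have 1: "((\<lambda>t. if k = 0 then a + t *\<^sub>R v else if k = 1 then v else 0) has_vector_derivative
        (if Suc k = 0 then a + t *\<^sub>R v else if Suc k = 1 then v else 0)) (at t)"
      by (auto intro!: derivative_eq_intros)
    have 2: "((\<lambda>t. w ^ k *\<^sub>R rot (w * t + real k * (pi / 2)) (x - a)) has_vector_derivative
        w ^ k *\<^sub>R (w *\<^sub>R rot (w * t + (real k * (pi / 2) + pi / 2)) (x - a))) (at t)"
      by (intro bounded_linear.has_vector_derivative[OF bounded_linear_scaleR_right]
          rot_has_vector_derivative)
    have "real (Suc k) * (pi / 2) = real k * (pi / 2) + pi / 2" by (simp add: algebra_simps)
    then have "D (Suc k) t = (if Suc k = 0 then a + t *\<^sub>R v else if Suc k = 1 then v else 0)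
        + w ^ k *\<^sub>R (w *\<^sub>R rot (w * t + (real k * (pi / 2) + pi / 2)) (x - a))"
      unfolding D_def by (simp only: scaleR_scaleR power_Suc2)
    moreover have "D k = (\<lambda>t. (if k = 0 then a + t *\<^sub>R v else if k = 1 then v else 0)
        + w ^ k *\<^sub>R rot (w * t + real k * (pi / 2)) (x - a))"
      by (simp add: D_def[abs_def])
    ultimately show ?thesis using has_vector_derivative_add[OF 1 2] by (simp only:)
  qed
  moreover have "D 0 = (\<lambda>t. a + t *\<^sub>R v + rot (w * t) (x - a))" by (simp add: D_def[abs_def])
  ultimately show "smooth_curve (\<lambda>t. a + t *\<^sub>R v + rot (w * t) (x - a))"
    unfolding smooth_curve_def by blast
qed

lemma orthogonal_independent_imp_0:
  assumes "z \<bullet> u = 0" "z \<bullet> v = 0" "cross2 u v \<noteq> 0"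
  shows "z = 0"
proof -
  have "u \<noteq> 0" using assms(3) by (auto simp: cross2_bilinear)
  then obtain r where "z = r *\<^sub>R perp u" using orthogonal_perp_multiple assms(1) by blast
  then show ?thesis using assms(2,3) by (simp add: perp_inner)
qed

text \<open>
  Normalise the flex by subtracting the infinitesimal motion that agrees with it at \<open>p a\<close> and
  \<open>p b\<close>. The remainder \<open>z\<close> still preserves all distances to first order, vanishes at these two
  points, hence at \<open>p c\<close>, and hence everywhere.
\<close>
lemma orthogonal_imp_trivial_flex:
  fixes p p' :: "nat \<Rightarrow> real ^ 2"
  assumes orth: "\<And>i j. i \<in> {1..n} \<Longrightarrow> j \<in> {1..n} \<Longrightarrow> (p i - p j) \<bullet> (p' i - p' j) = 0"
    and abc: "a \<in> {1..n}" "b \<in> {1..n}" "c \<in> {1..n}" "orient (p a) (p b) (p c) \<noteq> 0"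
  shows "trivial_flex n p p'"
proof -
  define v where "v i = p i - p a" for i
  have v_bc: "cross2 (v b) (v c) \<noteq> 0" using abc(4) by (simp add: v_def orient_def)
  then have "v b \<noteq> 0" by (auto simp: cross2_bilinear)
  moreover have "(p' b - p' a) \<bullet> v b = 0" using orth abc by (simp add: v_def inner_commute)
  ultimately obtain w where w: "p' b - p' a = w *\<^sub>R perp (v b)"
    using orthogonal_perp_multiple by blast
  define z where "z i = p' i - p' a - w *\<^sub>R perp (v i)" for i
  have zz: "(z i - z j) \<bullet> (v i - v j) = 0" if "i \<in> {1..n}" "j \<in> {1..n}" for i j
  proof -
    have "z i - z j = (p' i - p' j) - w *\<^sub>R perp (v i - v j)"
      by (simp add: z_def perp_linear algebra_simps)
    moreover have "v i - v j = p i - p j" by (simp add: v_def)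
    ultimately have "(z i - z j) \<bullet> (v i - v j)
        = (p' i - p' j) \<bullet> (p i - p j) - w * cross2 (p i - p j) (p i - p j)"
      by (simp only: inner_diff_left[of "p' i - p' j"] inner_scaleR_left perp_inner)
    then show ?thesis using orth[OF that] by (simp add: inner_commute cross2_bilinear)
  qed
  have "z a = 0" "v a = 0" by (simp_all add: z_def v_def perp_def vec2_eq_iff)
  then have zv: "z i \<bullet> v i = 0" if "i \<in> {1..n}" for i
    using zz[OF that abc(1)] by simp
  have zb: "z b = 0" using w by (simp add: z_def)
  have zvb: "z i \<bullet> v b = 0" if "i \<in> {1..n}" for i
    using zz[OF that abc(2)] zv[OF that] zb by (simp add: inner_diff_right)
  have zc: "z c = 0" using orthogonal_independent_imp_0[OF zvb zv v_bc] abc by simp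
  have zvc: "z i \<bullet> v c = 0" if "i \<in> {1..n}" for i
    using zz[OF that abc(3)] zv[OF that] zc by (simp add: inner_diff_right)
  have z0: "z i = 0" if "i \<in> {1..n}" for i
    using orthogonal_independent_imp_0[OF zvb zvc v_bc] that by simp
  define \<Phi> where "\<Phi> t x = p a + t *\<^sub>R p' a + rot (w * t) (x - p a)" for t x
  have "smooth_congruence_family \<Phi>"
    using smooth_congruence_family_rotation_translation[of "p a" "p' a" w] by (simp add: \<Phi>_def[abs_def])
  moreover have "\<Phi> 0 = id" by (auto simp: \<Phi>_def)
  moreover have "((\<lambda>t. \<Phi> t (p i)) has_vector_derivative p' i) (at 0)" if "i \<in> {1..n}" for i
  proof -
    have "((\<lambda>t. \<Phi> t (p i)) has_vector_derivative
        p' a + w *\<^sub>R rot (w * 0 + (0 + pi / 2)) (v i)) (at 0)"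
      unfolding \<Phi>_def v_def
      using rot_has_vector_derivative[of w 0 "p i - p a" 0]
      by (auto intro!: derivative_eq_intros)
    moreover have "p' a + w *\<^sub>R rot (w * 0 + (0 + pi / 2)) (v i) = p' i"
      using z0[OF that] by (simp add: rot_def z_def algebra_simps)
    ultimately show ?thesis by simp
  qed
  ultimately show ?thesis unfolding trivial_flex_def by blast
qed

section \<open>Equivalence of the two kinds of rigidity\<close>

text \<open>
  Finitely many strict inequalities between continuous functions survive a small perturbation.
\<close>
lemma ccw_perturbation:
  assumes "ccw s n P"
  shows "\<forall>\<^sub>F t in nhds 0. ccw s n (\<lambda>k. P k + t *\<^sub>R V k)"
proof -
  have *: "\<forall>\<^sub>F t in nhds 0. i < j \<longrightarrow> j < k \<longrightarrow>
      0 < s * orient (P i + t *\<^sub>R V i) (P j + t *\<^sub>R V j) (P k + t *\<^sub>R V k)"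
    if "i < n" "j < n" "k < n" for i j k
  proof (cases "i < j \<and> j < k")
    case True
    define f where "f t = s * orient (P i + t *\<^sub>R V i) (P j + t *\<^sub>R V j) (P k + t *\<^sub>R V k)" for t
    have "isCont f 0"
      unfolding f_def orient_def cross2_def vector_minus_component vector_add_component
        vector_scaleR_component by (intro continuous_intros)
    moreover have "0 < f 0" using assms True that by (simp add: f_def ccw_def)
    ultimately have "\<forall>\<^sub>F t in nhds 0. 0 < f t"
      using order_tendstoD(1)[of f "f 0" "nhds 0" 0] by (simp add: tendsto_nhds_iff continuous_at)
    then show ?thesis by eventually_elim (simp add: f_def)
  next
    case False
    then show ?thesis by (intro always_eventually) auto
  qed
  have "\<forall>\<^sub>F t in nhds 0. \<forall>i\<in>{..<n}. \<forall>j\<in>{..<n}. \<forall>k\<in>{..<n}. i < j \<longrightarrow> j < k \<longrightarrow>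
      0 < s * orient (P i + t *\<^sub>R V i) (P j + t *\<^sub>R V j) (P k + t *\<^sub>R V k)"
    using * by (intro eventually_ball_finite ballI finite_lessThan) auto
  then show ?thesis
    by eventually_elim (force simp: ccw_def)
qed

text \<open>
  A clockwise polygon becomes counterclockwise after a reflection; \<open>R\<close> is a reflection or the
  identity.
\<close>
lemma ccw_reflection:
  assumes P: "ccw s n P" and n: "n \<ge> 3"
  obtains R where "linear R" "\<And>x. norm (R x) = norm x" "ccw 1 n (\<lambda>k. R (P k))"
proof (cases "0 < s")
  case True
  then have "ccw 1 n P" using P by (simp add: ccw_def zero_less_mult_iff)
  then show ?thesis using that[of "\<lambda>x. x"] by (simp add: linear_ident)
next
  case False
  define R :: "real ^ 2 \<Rightarrow> real ^ 2" where "R x = vector [x $ 1, - x $ 2]" for x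
  have "orient (R a) (R b) (R c) = - orient a b c" for a b c
    by (simp add: R_def orient_def cross2_def algebra_simps)
  then have "ccw 1 n (\<lambda>k. R (P k))"
    using P False by (auto simp: ccw_def zero_less_mult_iff not_less)
  moreover have "linear R" by (rule linearI) (simp_all add: R_def vec2_eq_iff)
  moreover have "norm (R x) = norm x" for x
  proof -
    have "(norm (R x))\<^sup>2 = (norm x)\<^sup>2" unfolding norm_2_power2 by (simp add: R_def)
    then show ?thesis by (simp add: power2_eq_iff_nonneg)
  qed
  ultimately show ?thesis using that by blast
qed

text \<open>
  The identity behind both directions of the theorem: the difference of two frameworks is
  orthogonal to their sum along an edge if and only if the edge has the same length in both.
\<close>
lemma polarization_diff:
  fixes x y :: "'a :: real_inner"
  shows "(x + y) \<bullet> (x - y) = (norm x)\<^sup>2 - (norm y)\<^sup>2"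
  by (simp add: power2_norm_eq_inner algebra_simps inner_commute)

theorem theorem2p1:
  fixes n :: nat and E :: "nat set set"
  assumes "braced_polygon_graph n E"
  shows "(\<forall>p. strictly_convex_braced_polygon n E p \<longrightarrow> infinitesimally_rigid n E p) \<longleftrightarrow>
         (\<forall>p. strictly_convex_braced_polygon n E p \<longrightarrow> convexly_rigid n E p)"
proof -
  have n: "n \<ge> 3" and boundary: "boundary_edges n \<subseteq> E"
    using assms by (auto simp: braced_polygon_graph_def)
  have convex_iff: "strictly_convex_braced_polygon n E p \<longleftrightarrow> (\<exists>s. ccw s n (\<lambda>k. p (Suc k)))" for p
    using assms strictly_convex_polygon_imp_ccw[OF n] ccw_imp_strictly_convex_polygon[OF n]
    by (auto simp: strictly_convex_braced_polygon_def)
  show ?thesis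
  proof (intro iffI allI impI)
    fix p
    assume rigid: "\<forall>p. strictly_convex_braced_polygon n E p \<longrightarrow> infinitesimally_rigid n E p"
      and p: "strictly_convex_braced_polygon n E p"
    show "convexly_rigid n E p"
      unfolding convexly_rigid_def
    proof (intro allI impI)
      fix q
      assume q: "strictly_convex_braced_polygon n E q"
        and len: "\<forall>i j. {i, j} \<in> E \<longrightarrow> norm (q i - q j) = norm (p i - p j)"
      obtain R where R: "linear R" "\<And>x. norm (R x) = norm x" "ccw 1 n (\<lambda>k. R (p (Suc k)))"
        using p convex_iff ccw_reflection[OF _ n] by metis
      obtain S where S: "linear S" "\<And>x. norm (S x) = norm x" "ccw 1 n (\<lambda>k. S (q (Suc k)))"
        using q convex_iff ccw_reflection[OF _ n] by metis
      have "norm (edge n (\<lambda>k. R (p (Suc k))) k) = norm (edge n (\<lambda>k. S (q (Suc k))) k)"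
        if "k < n" for k
      proof -
        have "{Suc k, Suc (Suc k mod n)} \<in> boundary_edges n"
          unfolding boundary_edges_def cyc_next_def using that by auto
        then have "norm (q (Suc (Suc k mod n)) - q (Suc k)) = norm (p (Suc (Suc k mod n)) - p (Suc k))"
          using boundary len by (metis insert_commute subsetD)
        then show ?thesis
          using R S by (simp add: edge_def flip: linear_diff)
      qed
      then obtain c where c: "ccw 1 n (\<lambda>k. R (p (Suc k)) + rot c (S (q (Suc k))))"
        using ccw_average[OF n R(3) S(3)] by blast
      \<comment> \<open>\<open>P - Q\<close> is a flex of the averaged polygon \<open>P + Q\<close>\<close>
      define P Q where "P k = R (p k)" and "Q k = rot c (S (q k))" for k
      have normP: "norm (P i - P j) = norm (p i - p j)" for i j
        using R by (simp add: P_def flip: linear_diff)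
      have normQ: "norm (Q i - Q j) = norm (q i - q j)" for i j
        using S by (simp add: Q_def flip: linear_diff rot_diff)
      have prod: "((P i + Q i) - (P j + Q j)) \<bullet> ((P i - Q i) - (P j - Q j))
          = (norm (p i - p j))\<^sup>2 - (norm (q i - q j))\<^sup>2" for i j
        using polarization_diff[of "P i - P j" "Q i - Q j"] normP normQ by (simp add: algebra_simps)
      have "strictly_convex_braced_polygon n E (\<lambda>k. P k + Q k)"
        unfolding convex_iff using c by (auto simp: P_def Q_def)
      then have "infinitesimally_rigid n E (\<lambda>k. P k + Q k)" using rigid by blast
      moreover have "infinitesimal_flex E (\<lambda>k. P k + Q k) (\<lambda>k. P k - Q k)"
        unfolding infinitesimal_flex_def prod using len by simp
      ultimately have "trivial_flex n (\<lambda>k. P k + Q k) (\<lambda>k. P k - Q k)"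
        by (simp add: infinitesimally_rigid_def)
      then have "(norm (p i - p j))\<^sup>2 - (norm (q i - q j))\<^sup>2 = 0" if "i \<in> {1..n}" "j \<in> {1..n}" for i j
        using trivial_flex_imp_orthogonal[OF _ that] prod by fastforce
      then show "congruent n p q" unfolding congruent_def by simp
    qed
  next
    fix p
    assume rigid: "\<forall>p. strictly_convex_braced_polygon n E p \<longrightarrow> convexly_rigid n E p"
      and p: "strictly_convex_braced_polygon n E p"
    obtain s where s: "ccw s n (\<lambda>k. p (Suc k))" using p convex_iff by blast
    show "infinitesimally_rigid n E p"
      unfolding infinitesimally_rigid_def
    proof (intro allI impI)
      fix p' assume flex: "infinitesimal_flex E p p'"
      have "\<forall>\<^sub>F t in nhds 0. ccw s n (\<lambda>k. p (Suc k) + t *\<^sub>R p' (Suc k)) \<and>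
          ccw s n (\<lambda>k. p (Suc k) + t *\<^sub>R (- p' (Suc k)))"
        by (intro eventually_conj ccw_perturbation s)
      then obtain d where d: "0 < d" "\<And>t. \<bar>t\<bar> < d \<Longrightarrow> ccw s n (\<lambda>k. p (Suc k) + t *\<^sub>R p' (Suc k)) \<and>
          ccw s n (\<lambda>k. p (Suc k) + t *\<^sub>R (- p' (Suc k)))"
        unfolding eventually_nhds_metric by auto
      define t where "t = d / 2"
      have t: "0 < t" "\<bar>t\<bar> < d" using d by (auto simp: t_def)
      \<comment> \<open>moving along the flex and against it changes the length of an edge by the same amount\<close>
      define q r where "q k = p k + t *\<^sub>R p' k" and "r k = p k - t *\<^sub>R p' k" for k
      have "strictly_convex_braced_polygon n E q" "strictly_convex_braced_polygon n E r"
        unfolding convex_iff using d(2)[OF t(2)] by (auto simp: q_def r_def)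
      moreover have diff: "(norm (q i - q j))\<^sup>2 - (norm (r i - r j))\<^sup>2
          = 4 * t * ((p i - p j) \<bullet> (p' i - p' j))" for i j
      proof -
        have "(q i - q j) + (r i - r j) = 2 *\<^sub>R (p i - p j)"
          "(q i - q j) - (r i - r j) = (2 * t) *\<^sub>R (p' i - p' j)"
          by (simp_all add: q_def r_def vec2_eq_iff algebra_simps)
        then show ?thesis using polarization_diff[of "q i - q j" "r i - r j"] by simp
      qed
      moreover have "norm (r i - r j) = norm (q i - q j)" if "{i, j} \<in> E" for i j
        using flex that diff[of i j] by (simp add: infinitesimal_flex_def)
      ultimately have cong: "congruent n q r"
        using rigid unfolding convexly_rigid_def by blast
      have "(p i - p j) \<bullet> (p' i - p' j) = 0" if "i \<in> {1..n}" "j \<in> {1..n}" for i j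
      proof -
        have "norm (q i - q j) = norm (r i - r j)"
          using cong that unfolding congruent_def
          by (cases i j rule: linorder_cases) (simp, simp, metis norm_minus_commute)
        then show ?thesis using diff[of i j] t by simp
      qed
      moreover have "orient (p 1) (p 2) (p 3) \<noteq> 0"
        using ccw_orient_nonzero[OF s, of 0 1 2] n by (simp add: numeral_2_eq_2 numeral_3_eq_3)
      ultimately show "trivial_flex n p p'"
        using n by (intro orthogonal_imp_trivial_flex[of n p p' 1 2 3]) auto
    qed
  qed
qed

end
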